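(* Let $f=h+\overline g$ be an orientation-preserving harmonic mapping in $\mathbb D$ with $\|\omega_f\|_\infty<1$, let $c$ be the hyperbolic circumcenter of $\overline{\omega_f(\mathbb D)}$, and let $R=\operatorname{rad}_{\mathbb D}(\overline{\omega_f(\mathbb D)})$. If $R>0$, there exist $m\in\{2,3\}$ and points $\xi_1,\dots,\xi_m\in\overline{\omega_f(\mathbb D)}$ with $d_{\mathbb D}(c,\xi_j)=R$ for all $j$ such that $c$ is already the hyperbolic circumcenter of $\{\xi_1,\dots,\xi_m\}$. If $m=2$, then $c$ is the hyperbolic midpoint of $\xi_1$ and $\xi_2$. If $m=3$, the outward unit tangent vectors at $c$ pointing along the geodesics from $c$ toward the $\xi_j$ have the origin in their Euclidean convex hull in the tangent space $T_c\mathbb D$.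
   Context: $\mathbb D$ is the open unit disk in $\mathbb C$. An orientation-preserving harmonic mapping in $\mathbb D$ is a complex-valued harmonic function $f=h+\overline g$, with $h,g$ analytic in $\mathbb D$, whose Jacobian $|h'|^2-|g'|^2$ is positive everywhere; its complex dilatation $\omega_f=g'/h'$ is an analytic map $\mathbb D\to\mathbb D$. $\|\cdot\|_\infty$ is the supremum norm on $\mathbb D$. $\mathbb D$ carries the Poincaré metric $\frac{2|dz|}{1-|z|^2}$, with distance $d_{\mathbb D}(z_1,z_2)=2\operatorname{arctanh}\left|\frac{z_1-z_2}{1-\overline{z_2}z_1}\right|$. For a nonempty hyperbolically bounded set $E\subset\mathbb D$, $\operatorname{rad}_{\mathbb D}(E)=\inf_{c\in\mathbb D}\sup_{\zeta\in E}d_{\mathbb D}(c,\zeta)$; the infimum is attained at a unique point, the hyperbolic circumcenter of $E$. *)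

theory Defs
  imports "HOL-Analysis.Analysis"
begin

abbreviation unit_disk :: "complex set" where
  "unit_disk \<equiv> ball 0 1"

text \<open>Harmonicity of \<open>f\<close> is implied by the decomposition. The functions \<open>h\<close> and \<open>g\<close> are
  determined by \<open>f\<close> up to additive constants, so their derivatives, and with them the complex
  dilatation, depend on \<open>f\<close> only.\<close>

definition orientation_preserving_harmonic ::
    "(complex \<Rightarrow> complex) \<Rightarrow> (complex \<Rightarrow> complex) \<Rightarrow> (complex \<Rightarrow> complex) \<Rightarrow> bool" where
  "orientation_preserving_harmonic f h g \<longleftrightarrow>
     h analytic_on unit_disk \<and> g analytic_on unit_disk \<and>
     (\<forall>z\<in>unit_disk. f z = h z + cnj (g z)) \<and>
     (\<forall>z\<in>unit_disk. (cmod (deriv h z))\<^sup>2 - (cmod (deriv g z))\<^sup>2 > 0)"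

definition dilatation :: "(complex \<Rightarrow> complex) \<Rightarrow> (complex \<Rightarrow> complex) \<Rightarrow> complex \<Rightarrow> complex" where
  "dilatation h g z = deriv g z / deriv h z"

text \<open>Only meant for functions that are bounded on the disk, as is every dilatation of an
  orientation-preserving harmonic mapping.\<close>

definition sup_norm :: "(complex \<Rightarrow> complex) \<Rightarrow> real" where
  "sup_norm w = (SUP z\<in>unit_disk. cmod (w z))"

text \<open>Distance of the metric \<open>2 |dz| / (1 - |z|\<^sup>2)\<close>; meaningful for points of the disk.\<close>

definition hyp_dist :: "complex \<Rightarrow> complex \<Rightarrow> real" where
  "hyp_dist z1 z2 = 2 * artanh (cmod ((z1 - z2) / (1 - cnj z2 * z1)))"

text \<open>The suprema and infima below are taken in the reals, so \<open>E\<close> has to be a nonempty,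
  hyperbolically bounded subset of the disk; for such \<open>E\<close> the circumcenter exists and is unique.\<close>

definition hyp_rad :: "complex set \<Rightarrow> real" where
  "hyp_rad E = (INF c\<in>unit_disk. SUP \<zeta>\<in>E. hyp_dist c \<zeta>)"

definition hyp_circumcenter :: "complex set \<Rightarrow> complex" where
  "hyp_circumcenter E = (THE c. c \<in> unit_disk \<and> (SUP \<zeta>\<in>E. hyp_dist c \<zeta>) = hyp_rad E)"

text \<open>\<open>\<gamma>\<close> is the geodesic segment from \<open>x\<close> to \<open>y\<close>, parametrised by hyperbolic arc length.\<close>

definition hyp_geodesic :: "(real \<Rightarrow> complex) \<Rightarrow> complex \<Rightarrow> complex \<Rightarrow> bool" where
  "hyp_geodesic \<gamma> x y \<longleftrightarrow>
     \<gamma> 0 = x \<and> \<gamma> (hyp_dist x y) = y \<and> \<gamma> ` {0..hyp_dist x y} \<subseteq> unit_disk \<and>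
     (\<forall>s\<in>{0..hyp_dist x y}. \<forall>t\<in>{0..hyp_dist x y}. hyp_dist (\<gamma> s) (\<gamma> t) = \<bar>s - t\<bar>)"

definition hyp_midpoint :: "complex \<Rightarrow> complex \<Rightarrow> complex" where
  "hyp_midpoint x y = (THE m. \<exists>\<gamma>. hyp_geodesic \<gamma> x y \<and> m = \<gamma> (hyp_dist x y / 2))"

text \<open>The tangent space at a point of the disk is identified with the complex plane. Initial
  velocities of arc-length geodesics have length 1 in the Poincare metric, that is, Euclidean
  length \<open>(1 - |x|\<^sup>2) / 2\<close>. Meaningful for distinct points of the disk only.\<close>

definition hyp_unit_tangent :: "complex \<Rightarrow> complex \<Rightarrow> complex" where
  "hyp_unit_tangent x y =
     (THE v. \<exists>\<gamma>. hyp_geodesic \<gamma> x y \<and>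
        (\<gamma> has_vector_derivative v) (at 0 within {0..hyp_dist x y}))"

end

theory Submission
  imports Defs
begin

text \<open>Everything happens in the compact set \<open>K = closure (dilatation h g ` unit_disk)\<close>. Disk
  automorphisms are isometries, so a point \<open>a\<close> may be moved to \<open>0\<close>, where geodesics are radial.
  Comparing \<open>1 - |(z - \<xi>) / (1 - cnj \<xi> * z)|\<^sup>2\<close> with its value at \<open>z = 0\<close> shows: if \<open>0\<close> is a convex
  combination of points \<open>\<xi>\<close> of equal modulus, then every other \<open>z\<close> is farther than \<open>0\<close> from one of
  them; if \<open>0\<close> is not in the convex hull of the farthest points of \<open>K\<close>, a small step in a separating
  direction decreases the distance to all farthest points and keeps the others close. Hence \<open>a\<close> is
  the circumcenter of \<open>K\<close> iff, after moving \<open>a\<close> to \<open>0\<close>, the origin lies in the convex hull of the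
  farthest points, and Caratheodory's theorem in the plane leaves at most three of them.\<close>

section \<open>Identities for the real hyperbolic tangent\<close>

lemma tanh_artanh_real:
  fixes x :: real
  assumes "\<bar>x\<bar> < 1"
  shows "tanh (artanh x) = x"
proof -
  have pos: "1 + x > 0" "1 - x > 0"
    using assms by auto
  have "exp (- 2 * artanh x) = exp (- ln ((1 + x) / (1 - x)))"
    by (simp add: artanh_def)
  also have "\<dots> = (1 - x) / (1 + x)"
    using pos by (simp add: exp_minus)
  finally have "tanh (artanh x) = (1 - (1 - x) / (1 + x)) / (1 + (1 - x) / (1 + x))"
    by (simp only: tanh_real_altdef)
  also have "\<dots> = x"
    using pos by (simp add: divide_simps)
  finally show ?thesis .
qed

lemma tanh_diff_real:
  fixes x y :: real
  shows "tanh (x - y) = (tanh x - tanh y) / (1 - tanh x * tanh y)"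
  using tanh_add[of x "- y"] by simp

section \<open>Automorphisms of the disk\<close>

text \<open>For \<open>a\<close> in the disk this is the automorphism taking \<open>a\<close> to 0,
  with inverse \<open>disk_moebius (- a)\<close>; its modulus is the pseudo-hyperbolic distance from
  \<open>a\<close> to \<open>z\<close>.\<close>

definition disk_moebius :: "complex \<Rightarrow> complex \<Rightarrow> complex" where
  "disk_moebius a z = (z - a) / (1 - cnj a * z)"

lemma disk_moebius_0 [simp]: "disk_moebius 0 z = z"
  and disk_moebius_self [simp]: "disk_moebius a a = 0"
  and disk_moebius_minus_0 [simp]: "disk_moebius (- a) 0 = a"
  by (simp_all add: disk_moebius_def)

lemma disk_moebius_denom:
  assumes "a \<in> unit_disk" "z \<in> cball 0 1"
  shows "1 - cnj a * z \<noteq> 0"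
proof
  assume "1 - cnj a * z = 0"
  then have "cmod a * cmod z = 1"
    by (metis complex_mod_cnj eq_iff_diff_eq_0 norm_mult norm_one)
  moreover have "cmod a * cmod z \<le> cmod a * 1"
    using assms by (intro mult_left_mono) auto
  ultimately show False
    using assms by simp
qed

text \<open>Brings in the real inner product: through this expansion of the denominator, its sign
  decides comparisons of distances.\<close>

lemma norm_one_minus_cnj_mult:
  "(cmod (1 - cnj a * z))\<^sup>2 = 1 - 2 * (a \<bullet> z) + (cmod a)\<^sup>2 * (cmod z)\<^sup>2"
  unfolding cmod_power2 by (simp add: inner_complex_def algebra_simps power2_eq_square)

text \<open>The squared denominator exceeds the squared numerator by exactly
  \<open>(1 - (cmod a)\<^sup>2) * (1 - (cmod z)\<^sup>2)\<close>. This form turns comparisons of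
  distances into polynomial inequalities.\<close>

lemma norm_disk_moebius:
  assumes "a \<in> unit_disk" "z \<in> unit_disk"
  shows "1 - (cmod (disk_moebius a z))\<^sup>2
           = (1 - (cmod a)\<^sup>2) * (1 - (cmod z)\<^sup>2) / (cmod (1 - cnj a * z))\<^sup>2"
proof -
  have "cmod (1 - cnj a * z) \<noteq> 0"
    using assms disk_moebius_denom[of a z] by simp
  moreover have "(cmod (1 - cnj a * z))\<^sup>2 - (cmod (z - a))\<^sup>2
      = (1 - (cmod a)\<^sup>2) * (1 - (cmod z)\<^sup>2)"
    unfolding cmod_power2 by (simp add: algebra_simps power2_eq_square)
  ultimately show ?thesis
    by (simp add: disk_moebius_def norm_divide power_divide diff_divide_eq_iff divide_simps)
qed

lemma disk_moebius_in_disk: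
  assumes "a \<in> unit_disk" "z \<in> unit_disk"
  shows "disk_moebius a z \<in> unit_disk"
proof -
  have "cmod (1 - cnj a * z) \<noteq> 0"
    using assms disk_moebius_denom[of a z] by simp
  moreover have "1 - (cmod a)\<^sup>2 > 0" "1 - (cmod z)\<^sup>2 > 0"
    using assms by (simp_all add: abs_square_less_1)
  ultimately have "1 - (cmod (disk_moebius a z))\<^sup>2 > 0"
    unfolding norm_disk_moebius[OF assms] by simp
  then show ?thesis
    by (simp add: abs_square_less_1)
qed

lemma disk_moebius_inverse:
  assumes "a \<in> unit_disk" "z \<in> unit_disk"
  shows "disk_moebius (- a) (disk_moebius a z) = z"
proof -
  have a: "1 - cnj a * a \<noteq> 0" and z: "1 - cnj a * z \<noteq> 0"
    using assms disk_moebius_denom[of a a] disk_moebius_denom[of a z] by auto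
  have "(z - a) / (1 - cnj a * z) + a = (1 - cnj a * a) * z / (1 - cnj a * z)"
    using z by (simp add: divide_simps) (simp add: algebra_simps)
  moreover have "1 + cnj a * ((z - a) / (1 - cnj a * z)) = (1 - cnj a * a) / (1 - cnj a * z)"
    using z by (simp add: divide_simps) (simp add: algebra_simps)
  ultimately show ?thesis
    using a z by (simp add: disk_moebius_def)
qed

lemma disk_moebius_inverse':
  assumes "a \<in> unit_disk" "z \<in> unit_disk"
  shows "disk_moebius a (disk_moebius (- a) z) = z"
  using disk_moebius_inverse[of "- a" z] assms by simp

lemma norm_disk_moebius_commute: "cmod (disk_moebius a z) = cmod (disk_moebius z a)"
proof -
  have "cmod (1 - cnj a * z) = cmod (cnj (1 - cnj a * z))"
    by (rule complex_mod_cnj[symmetric])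
  also have "cnj (1 - cnj a * z) = 1 - cnj z * a"
    by (simp add: mult.commute)
  finally show ?thesis
    by (simp add: disk_moebius_def norm_divide norm_minus_commute)
qed

text \<open>The factor \<open>1 - cnj a * a\<close> cancels between numerator and denominator; what
  remains differs from \<open>disk_moebius w z\<close> by a quotient of complex conjugates, which
  has modulus 1.\<close>

lemma norm_disk_moebius_invariant:
  assumes a: "a \<in> unit_disk" and z: "z \<in> unit_disk" and w: "w \<in> unit_disk"
  shows "cmod (disk_moebius (disk_moebius a w) (disk_moebius a z)) = cmod (disk_moebius w z)"
proof -
  have nz: "1 - cnj a * a \<noteq> 0" "1 - cnj a * z \<noteq> 0" "1 - cnj a * w \<noteq> 0" "1 - cnj w * z \<noteq> 0"
      "1 - cnj w * a \<noteq> 0"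
    using assms disk_moebius_denom by auto
  have "disk_moebius a z - disk_moebius a w
      = (1 - cnj a * a) * (z - w) / ((1 - cnj a * z) * (1 - cnj a * w))"
    using nz by (simp add: disk_moebius_def divide_simps) (simp add: algebra_simps)
  moreover have "1 - cnj (disk_moebius a w) * disk_moebius a z
      = (1 - cnj a * a) * (1 - cnj w * z) / ((1 - cnj a * z) * (1 - cnj w * a))"
    using nz by (simp add: disk_moebius_def divide_simps mult.commute) (simp add: algebra_simps)
  ultimately have "disk_moebius (disk_moebius a w) (disk_moebius a z)
      = disk_moebius w z * ((1 - cnj w * a) / (1 - cnj a * w))"
    using nz by (simp add: disk_moebius_def)
  moreover have "cmod (1 - cnj w * a) = cmod (1 - cnj a * w)"
    using complex_mod_cnj[of "1 - cnj w * a"] by (simp add: mult.commute)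
  ultimately show ?thesis
    using nz by (simp add: norm_mult norm_divide)
qed

lemma continuous_on_disk_moebius:
  assumes "a \<in> unit_disk"
  shows "continuous_on unit_disk (disk_moebius a)"
  unfolding disk_moebius_def
  using disk_moebius_denom[OF assms] by (intro continuous_intros) auto

section \<open>Hyperbolic distance through disk automorphisms\<close>

lemma hyp_dist_eq: "hyp_dist z w = 2 * artanh (cmod (disk_moebius z w))"
  unfolding norm_disk_moebius_commute[of z w] by (simp add: hyp_dist_def disk_moebius_def)

lemma hyp_dist_commute: "hyp_dist z w = hyp_dist w z"
  by (simp add: hyp_dist_eq norm_disk_moebius_commute)

text \<open>The modulus is below 1, where \<open>tanh\<close> inverts \<open>artanh\<close>. Since
  \<open>tanh\<close> is strictly increasing, comparisons of distances reduce to comparisons of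
  moduli.\<close>

lemma tanh_half_hyp_dist:
  assumes "z \<in> unit_disk" "w \<in> unit_disk"
  shows "tanh (hyp_dist z w / 2) = cmod (disk_moebius z w)"
  using disk_moebius_in_disk[OF assms] by (simp add: hyp_dist_eq tanh_artanh_real)

lemma hyp_dist_le_iff:
  assumes "z \<in> unit_disk" "w \<in> unit_disk"
  shows "hyp_dist z w \<le> \<rho> \<longleftrightarrow> cmod (disk_moebius z w) \<le> tanh (\<rho> / 2)"
  by (simp flip: tanh_half_hyp_dist[OF assms])

lemma hyp_dist_less_iff:
  assumes "z \<in> unit_disk" "w \<in> unit_disk"
  shows "hyp_dist z w < \<rho> \<longleftrightarrow> cmod (disk_moebius z w) < tanh (\<rho> / 2)"
  by (simp flip: tanh_half_hyp_dist[OF assms])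

lemma hyp_dist_eq_iff:
  assumes "z \<in> unit_disk" "w \<in> unit_disk"
  shows "hyp_dist z w = \<rho> \<longleftrightarrow> cmod (disk_moebius z w) = tanh (\<rho> / 2)"
  by (simp flip: tanh_half_hyp_dist[OF assms])

lemma hyp_dist_nonneg:
  assumes "z \<in> unit_disk" "w \<in> unit_disk"
  shows "hyp_dist z w \<ge> 0"
  using tanh_half_hyp_dist[OF assms] tanh_real_nonneg_iff[of "hyp_dist z w / 2"] by simp

lemma hyp_dist_disk_moebius:
  assumes "a \<in> unit_disk" "z \<in> unit_disk" "w \<in> unit_disk"
  shows "hyp_dist (disk_moebius a z) (disk_moebius a w) = hyp_dist z w"
  using norm_disk_moebius_invariant[of a w z] assms by (simp add: hyp_dist_eq)

lemma continuous_on_hyp_dist: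
  assumes "z \<in> unit_disk"
  shows "continuous_on unit_disk (hyp_dist z)"
proof -
  have "cmod (disk_moebius z w) < 1" if "w \<in> unit_disk" for w
    using disk_moebius_in_disk[OF assms that] by simp
  then have "cmod (disk_moebius z w) \<in> {-1<..<1}" if "w \<in> unit_disk" for w
    using that less_le_trans[OF _ norm_ge_zero, of "-1" "disk_moebius z w"] by simp
  then have "continuous_on unit_disk (\<lambda>w. artanh (cmod (disk_moebius z w)))"
    using continuous_on_compose2[OF continuous_on_artanh[OF order_refl]
        continuous_on_norm[OF continuous_on_disk_moebius[OF assms]]] by blast
  then have "continuous_on unit_disk (\<lambda>w. 2 * artanh (cmod (disk_moebius z w)))"
    by (intro continuous_on_mult continuous_on_const)
  then show ?thesis
    by (simp add: hyp_dist_eq[abs_def])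
qed

text \<open>Square two nonnegative quantities and clear the denominator. The resulting inequality is
  a closed condition also outside the disk, which later gives compact sublevel sets.\<close>

lemma hyp_dist_le_iff_poly:
  assumes "z \<in> unit_disk" "w \<in> unit_disk" "\<rho> \<ge> 0"
  shows "hyp_dist z w \<le> \<rho> \<longleftrightarrow>
    (1 - (tanh (\<rho> / 2))\<^sup>2) * (cmod (1 - cnj z * w))\<^sup>2 \<le> (1 - (cmod z)\<^sup>2) * (1 - (cmod w)\<^sup>2)"
proof -
  have "cmod (1 - cnj z * w) \<noteq> 0"
    using assms disk_moebius_denom[of z w] by simp
  moreover have "hyp_dist z w \<le> \<rho> \<longleftrightarrow> (cmod (disk_moebius z w))\<^sup>2 \<le> (tanh (\<rho> / 2))\<^sup>2"
    using assms by (simp add: hyp_dist_le_iff power2_le_iff_abs_le flip: abs_le_square_iff)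
  then have "hyp_dist z w \<le> \<rho> \<longleftrightarrow> 1 - (tanh (\<rho> / 2))\<^sup>2 \<le> 1 - (cmod (disk_moebius z w))\<^sup>2"
    by linarith
  ultimately show ?thesis
    unfolding norm_disk_moebius[OF assms(1,2)] by (simp add: pos_le_divide_eq)
qed

section \<open>Farthest points and the convex hull criterion\<close>

text \<open>When the inner product is not positive, \<open>?D\<close> is at least 1 and so exceeds
  \<open>1 - (cmod z)\<^sup>2\<close>; hence moving from 0 to \<open>z\<close> increases the
  distance to \<xi>.\<close>

lemma hyp_dist_origin_less:
  assumes z: "z \<in> unit_disk" "z \<noteq> 0" and \<xi>: "\<xi> \<in> unit_disk" and "\<xi> \<bullet> z \<le> 0"
  shows "hyp_dist 0 \<xi> < hyp_dist z \<xi>"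
proof -
  let ?D = "(cmod (1 - cnj \<xi> * z))\<^sup>2"
  have "1 - (cmod z)\<^sup>2 < ?D"
    unfolding norm_one_minus_cnj_mult using assms
    by (smt (verit) mult_nonneg_nonneg zero_less_norm_iff zero_le_power2 zero_less_power2)
  moreover have "1 - (cmod \<xi>)\<^sup>2 > 0" "1 - (cmod z)\<^sup>2 > 0"
    using assms by (simp_all add: abs_square_less_1)
  ultimately have "(1 - (cmod \<xi>)\<^sup>2) * (1 - (cmod z)\<^sup>2) / ?D < 1 - (cmod \<xi>)\<^sup>2"
    by (simp add: divide_less_eq)
  then have "(cmod \<xi>)\<^sup>2 < (cmod (disk_moebius \<xi> z))\<^sup>2"
    using norm_disk_moebius[OF \<xi> z(1)] by linarith
  then have "cmod \<xi> < cmod (disk_moebius z \<xi>)"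
    by (simp add: norm_disk_moebius_commute power_less_imp_less_base)
  then show ?thesis
    using assms by (subst hyp_dist_less_iff) (simp_all add: tanh_half_hyp_dist)
qed

text \<open>The witness is \<open>t *\<^sub>R v\<close>, with \<open>v\<close> normal to a line
  separating 0 from the hull. Points beyond the line get closer to first order in \<open>t\<close>;
  the others have a uniform slack that absorbs any loss for small \<open>t\<close>.\<close>

lemma exists_closer_point_origin:
  assumes K: "compact K" "K \<subseteq> unit_disk" and r: "0 \<le> r" "r < 1"
    and le: "\<And>\<xi>. \<xi> \<in> K \<Longrightarrow> cmod \<xi> \<le> r"
    and hull: "0 \<notin> convex hull {\<xi> \<in> K. cmod \<xi> = r}"
  shows "\<exists>z\<in>unit_disk. \<forall>\<xi>\<in>K. cmod (disk_moebius z \<xi>) < r"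
proof -
  have "{\<xi> \<in> K. cmod \<xi> = r} = K \<inter> sphere 0 r"
    by auto
  then have "compact {\<xi> \<in> K. cmod \<xi> = r}"
    using K by (simp add: compact_Int_closed)
  then obtain v b where b: "b > 0" and sep: "\<And>x. x \<in> convex hull {\<xi> \<in> K. cmod \<xi> = r} \<Longrightarrow> b < v \<bullet> x"
    using separating_hyperplane_closed_0[of "convex hull {\<xi> \<in> K. cmod \<xi> = r}"] hull
    by (auto simp: compact_imp_closed compact_convex_hull)
  \<comment> \<open>The points on the side of 0. None has modulus \<open>r\<close>, as those satisfy
    \<open>v \<bullet> \<xi> > b\<close>, so compactness gives a uniform gap \<open>p\<close>; for
    empty \<open>K1\<close> the value 1 is a mere placeholder.\<close>
  define K1 where "K1 = K \<inter> {\<xi>. v \<bullet> \<xi> \<le> b}"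
  have "compact K1"
    unfolding K1_def using K by (intro compact_Int_closed closed_halfspace_le)
  have less: "cmod \<xi> < r" if "\<xi> \<in> K1" for \<xi>
  proof -
    have "cmod \<xi> \<noteq> r"
      using that sep[OF hull_inc, of \<xi>] by (auto simp: K1_def)
    then show ?thesis
      using le[of \<xi>] that by (auto simp: K1_def)
  qed
  obtain p where p: "p > 0" and gap: "\<And>\<xi>. \<xi> \<in> K1 \<Longrightarrow> p \<le> r\<^sup>2 - (cmod \<xi>)\<^sup>2"
  proof (cases "K1 = {}")
    case True
    then show ?thesis
      using that[of 1] by simp
  next
    case False
    have "continuous_on K1 (\<lambda>\<xi>. r\<^sup>2 - (cmod \<xi>)\<^sup>2)"
      by (intro continuous_intros)
    then obtain \<xi> where \<xi>: "\<xi> \<in> K1" "\<And>\<eta>. \<eta> \<in> K1 \<Longrightarrow> r\<^sup>2 - (cmod \<xi>)\<^sup>2 \<le> r\<^sup>2 - (cmod \<eta>)\<^sup>2"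
      using continuous_attains_inf[OF \<open>compact K1\<close> False, of "\<lambda>\<xi>. r\<^sup>2 - (cmod \<xi>)\<^sup>2"]
      by blast
    moreover have "(cmod \<xi>)\<^sup>2 < r\<^sup>2"
      using less[OF \<xi>(1)] by (intro power_strict_mono) auto
    ultimately show ?thesis
      using that[of "r\<^sup>2 - (cmod \<xi>)\<^sup>2"] by simp
  qed
  have r2: "0 < 1 - r\<^sup>2" "1 - r\<^sup>2 \<le> 1"
    using r by (simp_all add: abs_square_less_1)
  define V where "V = (cmod v)\<^sup>2"
  have "V \<ge> 0"
    by (simp add: V_def)
  \<comment> \<open>The second condition keeps \<open>t *\<^sub>R v\<close> in the disk. The third
    lets the first-order gain beat the quadratic error off \<open>K1\<close>; the fourth lets the
    gap \<open>p\<close> beat first-order loss and quadratic error on \<open>K1\<close>.\<close>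
  have "\<forall>\<^sub>F t in at_right 0. 0 < t \<and> t * cmod v < 1 \<and> 2 * t * V < 2 * (1 - r\<^sup>2) * b \<and>
      2 * t * cmod v + 2 * t\<^sup>2 * V < p"
  proof (intro eventually_conj)
    show "\<forall>\<^sub>F t::real in at_right 0. 0 < t"
      by (simp add: eventually_at_right_less)
    have "((\<lambda>t. t * cmod v) \<longlongrightarrow> 0 * cmod v) (at_right 0)"
      by (intro tendsto_intros)
    then show "\<forall>\<^sub>F t in at_right 0. t * cmod v < 1"
      by (rule order_tendstoD) simp
    have "((\<lambda>t. 2 * t * V) \<longlongrightarrow> 2 * 0 * V) (at_right 0)"
      by (intro tendsto_intros)
    then show "\<forall>\<^sub>F t in at_right 0. 2 * t * V < 2 * (1 - r\<^sup>2) * b"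
      by (rule order_tendstoD) (use r2 b in simp)
    have "((\<lambda>t. 2 * t * cmod v + 2 * t\<^sup>2 * V) \<longlongrightarrow> 2 * 0 * cmod v + 2 * 0\<^sup>2 * V) (at_right 0)"
      by (intro tendsto_intros)
    then show "\<forall>\<^sub>F t in at_right 0. 2 * t * cmod v + 2 * t\<^sup>2 * V < p"
      by (rule order_tendstoD) (use p in simp)
  qed
  then obtain t where t: "t > 0" "t * cmod v < 1" "2 * t * V < 2 * (1 - r\<^sup>2) * b"
      "2 * t * cmod v + 2 * t\<^sup>2 * V < p"
    using eventually_happens[of _ "at_right (0::real)"] trivial_limit_at_right_real by blast
  define z where "z = t *\<^sub>R v"
  have z: "z \<in> unit_disk"
    using t by (simp add: z_def)
  have normz: "(cmod z)\<^sup>2 = t\<^sup>2 * V"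
    by (simp add: z_def V_def power_mult_distrib)
  have "cmod (disk_moebius z \<xi>) < r" if "\<xi> \<in> K" for \<xi>
  proof -
    have \<xi>: "\<xi> \<in> unit_disk" and \<xi>r: "(cmod \<xi>)\<^sup>2 \<le> r\<^sup>2"
      using that K le[of \<xi>] by (auto intro: power_mono)
    \<comment> \<open>The quantity to be made positive is this left side minus
      \<open>t\<^sup>2 * V\<close> times a factor that is at most 2; hence the bound
      \<open>2 * t\<^sup>2 * V\<close>.\<close>
    have main: "r\<^sup>2 - (cmod \<xi>)\<^sup>2 + 2 * t * (1 - r\<^sup>2) * (v \<bullet> \<xi>) > 2 * t\<^sup>2 * V"
    proof (cases "\<xi> \<in> K1")
      case True
      have "\<bar>v \<bullet> \<xi>\<bar> \<le> cmod v * cmod \<xi>"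
        by (rule Cauchy_Schwarz_ineq2)
      also have "\<dots> \<le> cmod v * 1"
        using \<xi> by (intro mult_left_mono) auto
      finally have "\<bar>(1 - r\<^sup>2) * (v \<bullet> \<xi>)\<bar> \<le> 1 * cmod v"
        unfolding abs_mult using r2 by (intro mult_mono) auto
      then have "t * \<bar>(1 - r\<^sup>2) * (v \<bullet> \<xi>)\<bar> \<le> t * cmod v"
        using t by (intro mult_left_mono) auto
      then have "\<bar>t * ((1 - r\<^sup>2) * (v \<bullet> \<xi>))\<bar> \<le> t * cmod v"
        using t by (simp add: abs_mult)
      then have "- (2 * t * (1 - r\<^sup>2) * (v \<bullet> \<xi>)) \<le> 2 * t * cmod v"
        by (simp only: mult.assoc)
      then show ?thesis
        using gap[OF True] t(4) by linarith
    next
      case False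
      then have "b \<le> v \<bullet> \<xi>"
        using that by (simp add: K1_def)
      then have "2 * (1 - r\<^sup>2) * b \<le> 2 * (1 - r\<^sup>2) * (v \<bullet> \<xi>)"
        using r2 by (intro mult_left_mono) auto
      then have "t * (2 * t * V) < t * (2 * (1 - r\<^sup>2) * (v \<bullet> \<xi>))"
        using t by (intro mult_strict_left_mono) auto
      then show ?thesis
        using \<xi>r by (simp add: power2_eq_square mult_ac)
    qed
    have "(1 - (cmod \<xi>)\<^sup>2) + (1 - r\<^sup>2) * (cmod \<xi>)\<^sup>2 \<le> 2"
      using r2 \<xi>r mult_mono[of "1 - r\<^sup>2" 1 "(cmod \<xi>)\<^sup>2" 1] by (simp, smt (verit) zero_le_power2)
    then have "t\<^sup>2 * V * ((1 - (cmod \<xi>)\<^sup>2) + (1 - r\<^sup>2) * (cmod \<xi>)\<^sup>2) \<le> t\<^sup>2 * V * 2"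
      using \<open>V \<ge> 0\<close> by (intro mult_left_mono) auto
    moreover have "(1 - (cmod z)\<^sup>2) * (1 - (cmod \<xi>)\<^sup>2) - (1 - r\<^sup>2) * (cmod (1 - cnj z * \<xi>))\<^sup>2
        = r\<^sup>2 - (cmod \<xi>)\<^sup>2 + 2 * t * (1 - r\<^sup>2) * (v \<bullet> \<xi>)
          - t\<^sup>2 * V * ((1 - (cmod \<xi>)\<^sup>2) + (1 - r\<^sup>2) * (cmod \<xi>)\<^sup>2)"
      unfolding norm_one_minus_cnj_mult normz by (simp add: z_def algebra_simps)
    ultimately have "(1 - r\<^sup>2) * (cmod (1 - cnj z * \<xi>))\<^sup>2 < (1 - (cmod z)\<^sup>2) * (1 - (cmod \<xi>)\<^sup>2)"
      using main by linarith
    moreover have "cmod (1 - cnj z * \<xi>) \<noteq> 0"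
      using z \<xi> disk_moebius_denom[of z \<xi>] by simp
    ultimately have "1 - r\<^sup>2 < 1 - (cmod (disk_moebius z \<xi>))\<^sup>2"
      unfolding norm_disk_moebius[OF z \<xi>] by (simp add: pos_less_divide_eq)
    then show ?thesis
      using r by (simp add: power_less_imp_less_base)
  qed
  then show ?thesis
    using z by blast
qed

text \<open>Move \<open>a\<close> to 0, where distance \<rho> becomes modulus
  \<open>tanh (\<rho> / 2)\<close>, and pull the point found there back by
  \<open>disk_moebius (- a)\<close>.\<close>

lemma exists_closer_point:
  assumes K: "compact K" "K \<subseteq> unit_disk" and a: "a \<in> unit_disk" and "\<rho> \<ge> 0"
    and le: "\<And>\<xi>. \<xi> \<in> K \<Longrightarrow> hyp_dist a \<xi> \<le> \<rho>"
    and hull: "0 \<notin> convex hull (disk_moebius a ` {\<xi> \<in> K. hyp_dist a \<xi> = \<rho>})"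
  shows "\<exists>z\<in>unit_disk. \<forall>\<xi>\<in>K. hyp_dist z \<xi> < \<rho>"
proof -
  define K' r where "K' = disk_moebius a ` K" and "r = tanh (\<rho> / 2)"
  have eq: "{\<xi> \<in> K'. cmod \<xi> = r} = disk_moebius a ` {\<xi> \<in> K. hyp_dist a \<xi> = \<rho>}"
    unfolding K'_def r_def using K hyp_dist_eq_iff[OF a] by blast
  have "\<exists>z\<in>unit_disk. \<forall>\<xi>\<in>K'. cmod (disk_moebius z \<xi>) < r"
  proof (rule exists_closer_point_origin)
    show "compact K'"
      unfolding K'_def using K a continuous_on_disk_moebius
      by (blast intro: compact_continuous_image continuous_on_subset)
    show "K' \<subseteq> unit_disk"
      unfolding K'_def using K a disk_moebius_in_disk by blast
    show "cmod \<xi> \<le> r" if "\<xi> \<in> K'" for \<xi>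
      using that le K(2) hyp_dist_le_iff[OF a] unfolding K'_def r_def by blast
    show "0 \<notin> convex hull {\<xi> \<in> K'. cmod \<xi> = r}"
      using hull unfolding eq .
  qed (use \<open>\<rho> \<ge> 0\<close> in \<open>simp_all add: r_def tanh_real_lt_1\<close>)
  then obtain z where z: "z \<in> unit_disk" and less: "\<And>\<xi>. \<xi> \<in> K \<Longrightarrow> cmod (disk_moebius z (disk_moebius a \<xi>)) < r"
    by (auto simp: K'_def)
  have z': "disk_moebius (- a) z \<in> unit_disk"
    using a z by (intro disk_moebius_in_disk) auto
  have "hyp_dist (disk_moebius (- a) z) \<xi> < \<rho>" if "\<xi> \<in> K" for \<xi>
  proof -
    have \<xi>: "\<xi> \<in> unit_disk"
      using that K by auto
    have "hyp_dist (disk_moebius (- a) z) \<xi> = hyp_dist z (disk_moebius a \<xi>)"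
      using hyp_dist_disk_moebius[OF a z' \<xi>] disk_moebius_inverse'[OF a z] by simp
    also have "\<dots> < \<rho>"
      using less[OF that] hyp_dist_less_iff[OF z disk_moebius_in_disk[OF a \<xi>]] by (simp add: r_def)
    finally show ?thesis .
  qed
  then show ?thesis
    using z' by blast
qed

text \<open>If all images of \<open>S\<close> had positive inner product with the image
  \<open>z'\<close> of \<open>z\<close>, their hull would lie in an open half-plane missing 0. So
  some image has inner product at most 0 with \<open>z'\<close>, and
  \<open>hyp_dist_origin_less\<close> applies to it.\<close>

lemma exists_farther_point:
  assumes S: "S \<subseteq> unit_disk" and a: "a \<in> unit_disk"
    and eq: "\<And>\<xi>. \<xi> \<in> S \<Longrightarrow> hyp_dist a \<xi> = \<rho>"
    and hull: "0 \<in> convex hull (disk_moebius a ` S)"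
    and z: "z \<in> unit_disk" "z \<noteq> a"
  shows "\<exists>\<xi>\<in>S. \<rho> < hyp_dist z \<xi>"
proof -
  define z' where "z' = disk_moebius a z"
  have z': "z' \<in> unit_disk"
    unfolding z'_def using a z(1) by (rule disk_moebius_in_disk)
  have "z' \<noteq> 0"
    using disk_moebius_inverse[OF a z(1)] z(2) by (auto simp: z'_def)
  have "\<exists>\<xi>\<in>S. z' \<bullet> disk_moebius a \<xi> \<le> 0"
  proof (rule ccontr)
    assume "\<not> ?thesis"
    then have "convex hull (disk_moebius a ` S) \<subseteq> {x. z' \<bullet> x > 0}"
      by (intro hull_minimal convex_halfspace_gt) (auto simp: not_le)
    then show False
      using hull by auto
  qed
  then obtain \<xi> where \<xi>: "\<xi> \<in> S" "z' \<bullet> disk_moebius a \<xi> \<le> 0"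
    by blast
  have "\<xi> \<in> unit_disk"
    using \<xi> S by blast
  then have "hyp_dist 0 (disk_moebius a \<xi>) < hyp_dist z' (disk_moebius a \<xi>)"
    using a z' \<open>z' \<noteq> 0\<close> \<xi> disk_moebius_in_disk
    by (intro hyp_dist_origin_less) (auto simp: inner_commute)
  then have "hyp_dist (disk_moebius a a) (disk_moebius a \<xi>) < hyp_dist z \<xi>"
    unfolding z'_def using hyp_dist_disk_moebius[OF a z(1) \<open>\<xi> \<in> unit_disk\<close>] by simp
  then show ?thesis
    using hyp_dist_disk_moebius[OF a a \<open>\<xi> \<in> unit_disk\<close>] eq \<xi> by auto
qed

section \<open>Circumradius and circumcenter of a compact set\<close>

lemma SUP_hyp_dist_attained:
  assumes "compact K" "K \<noteq> {}" "K \<subseteq> unit_disk" "z \<in> unit_disk"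
  obtains \<xi> where "\<xi> \<in> K" "(SUP \<zeta>\<in>K. hyp_dist z \<zeta>) = hyp_dist z \<xi>"
    "\<And>\<zeta>. \<zeta> \<in> K \<Longrightarrow> hyp_dist z \<zeta> \<le> hyp_dist z \<xi>"
proof -
  obtain \<xi> where \<xi>: "\<xi> \<in> K" "\<And>\<zeta>. \<zeta> \<in> K \<Longrightarrow> hyp_dist z \<zeta> \<le> hyp_dist z \<xi>"
    using continuous_attains_sup[of K "hyp_dist z"] assms continuous_on_hyp_dist
    by (blast intro: continuous_on_subset)
  then have "(SUP \<zeta>\<in>K. hyp_dist z \<zeta>) = hyp_dist z \<xi>"
    by (intro cSup_eq_maximum) auto
  then show ?thesis
    using that \<xi> by blast
qed

lemma bdd_below_SUP_hyp_dist:
  assumes "compact K" "K \<noteq> {}" "K \<subseteq> unit_disk"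
  shows "bdd_below ((\<lambda>z. SUP \<zeta>\<in>K. hyp_dist z \<zeta>) ` unit_disk)"
proof (rule bdd_belowI2[of _ 0])
  fix z :: complex assume z: "z \<in> unit_disk"
  obtain \<xi> where "\<xi> \<in> K" "(SUP \<zeta>\<in>K. hyp_dist z \<zeta>) = hyp_dist z \<xi>"
    using SUP_hyp_dist_attained[OF assms z] by blast
  then show "0 \<le> (SUP \<zeta>\<in>K. hyp_dist z \<zeta>)"
    using assms hyp_dist_nonneg[OF z] by auto
qed

text \<open>By \<open>exists_farther_point\<close> every other center has a supremum above \<rho>,
  so \<open>a\<close> is the only minimiser and the definite description picks it. This serves both
  for the whole compact set and for the finite selection from it.\<close>

lemma hyp_circumcenter_eqI:
  assumes K: "compact K" "K \<subseteq> unit_disk" and a: "a \<in> unit_disk"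
    and le: "\<And>\<xi>. \<xi> \<in> K \<Longrightarrow> hyp_dist a \<xi> \<le> \<rho>"
    and hull: "0 \<in> convex hull (disk_moebius a ` {\<xi> \<in> K. hyp_dist a \<xi> = \<rho>})"
  shows "hyp_rad K = \<rho>" "hyp_circumcenter K = a"
proof -
  let ?s = "\<lambda>z. SUP \<zeta>\<in>K. hyp_dist z \<zeta>"
  \<comment> \<open>The hull of the empty set is empty, so the bound \<rho> is attained on
    \<open>K\<close>.\<close>
  have "{\<xi> \<in> K. hyp_dist a \<xi> = \<rho>} \<noteq> {}"
    using hull by (metis convex_hull_empty empty_iff image_empty)
  then have K0: "K \<noteq> {}" and sa: "?s a = \<rho>"
    using le by (auto intro!: cSup_eq_maximum)
  have gt: "?s z > \<rho>" if z: "z \<in> unit_disk" "z \<noteq> a" for z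
  proof -
    obtain \<xi> where "\<xi> \<in> K" "\<rho> < hyp_dist z \<xi>"
      using exists_farther_point[OF _ a _ hull z, of \<rho>] K(2) by blast
    moreover obtain \<eta> where "?s z = hyp_dist z \<eta>" "\<And>\<zeta>. \<zeta> \<in> K \<Longrightarrow> hyp_dist z \<zeta> \<le> hyp_dist z \<eta>"
      using SUP_hyp_dist_attained[OF K(1) K0 K(2) z(1)] by blast
    ultimately show ?thesis
      by fastforce
  qed
  show rad: "hyp_rad K = \<rho>"
    unfolding hyp_rad_def
  proof (rule cInf_eq_minimum)
    show "\<rho> \<in> ?s ` unit_disk"
      using sa a by (intro image_eqI[of _ _ a]) auto
    show "\<rho> \<le> x" if "x \<in> ?s ` unit_disk" for x
      using that gt sa by fastforce
  qed
  show "hyp_circumcenter K = a"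
    unfolding hyp_circumcenter_def rad
    using a sa gt by (intro the_equality) force+
qed

text \<open>Compactness: the sublevel sets for levels strictly above the infimum are nested,
  nonempty and compact, and a common point has all its distances to \<open>K\<close> bounded by the
  infimum.\<close>

lemma hyp_rad_attained:
  assumes K: "compact K" "K \<noteq> {}" "K \<subseteq> unit_disk"
  obtains a where "a \<in> unit_disk" "\<And>\<xi>. \<xi> \<in> K \<Longrightarrow> hyp_dist a \<xi> \<le> hyp_rad K"
proof -
  define \<rho> where "\<rho> n = hyp_rad K + 1 / real (Suc n)" for n
  have "hyp_rad K \<ge> 0"
    unfolding hyp_rad_def
  proof (rule cINF_greatest)
    fix z :: complex assume z: "z \<in> unit_disk"
    obtain \<xi> where "\<xi> \<in> K" "(SUP \<zeta>\<in>K. hyp_dist z \<zeta>) = hyp_dist z \<xi>"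
      using SUP_hyp_dist_attained[OF K z] by blast
    then show "0 \<le> (SUP \<zeta>\<in>K. hyp_dist z \<zeta>)"
      using K hyp_dist_nonneg[OF z] by auto
  qed auto
  then have \<rho>: "\<rho> n \<ge> 0" for n
    by (simp add: \<rho>_def)
  \<comment> \<open>Without denominators the sublevel sets are closed conditions on the closed disk, and on its
    boundary they fail.\<close>
  define S where "S n = {z \<in> cball 0 1. \<forall>\<xi>\<in>K.
    (1 - (tanh (\<rho> n / 2))\<^sup>2) * (cmod (1 - cnj \<xi> * z))\<^sup>2 \<le> (1 - (cmod \<xi>)\<^sup>2) * (1 - (cmod z)\<^sup>2)}" for n
  have S: "z \<in> S n \<longleftrightarrow> z \<in> unit_disk \<and> (\<forall>\<xi>\<in>K. hyp_dist z \<xi> \<le> \<rho> n)" for z n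
  proof (cases "z \<in> unit_disk")
    case True
    then have "hyp_dist z \<xi> \<le> \<rho> n \<longleftrightarrow>
      (1 - (tanh (\<rho> n / 2))\<^sup>2) * (cmod (1 - cnj \<xi> * z))\<^sup>2 \<le> (1 - (cmod \<xi>)\<^sup>2) * (1 - (cmod z)\<^sup>2)"
      if "\<xi> \<in> K" for \<xi>
      using that K hyp_dist_le_iff_poly[of \<xi> z] \<rho> by (auto simp: hyp_dist_commute)
    then show ?thesis
      using True by (auto simp: S_def)
  next
    case False
    have "z \<notin> S n"
    proof
      assume "z \<in> S n"
      then have z: "cmod z = 1"
        using False by (auto simp: S_def)
      \<comment> \<open>A single point of \<open>K\<close> excludes \<open>z\<close>: on the unit
        circle the right side of the inequality vanishes while the left side is positive.\<close>
      obtain \<xi> where \<xi>: "\<xi> \<in> K"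
        using K by blast
      then have "cmod (1 - cnj \<xi> * z) \<noteq> 0"
        using z K disk_moebius_denom[of \<xi> z] by auto
      moreover have "1 - (tanh (\<rho> n / 2))\<^sup>2 > 0"
        using tanh_real_bounds[of "\<rho> n / 2"] by (simp add: abs_square_less_1 abs_less_iff)
      ultimately have "(1 - (tanh (\<rho> n / 2))\<^sup>2) * (cmod (1 - cnj \<xi> * z))\<^sup>2 > 0"
        by simp
      then show False
        using \<open>z \<in> S n\<close> \<xi> z by (fastforce simp: S_def)
    qed
    then show ?thesis
      using False by blast
  qed
  have "\<Inter>(range S) \<noteq> {}"
  proof (rule compact_nest)
    fix n
    have "S n = cball 0 1 \<inter> (\<Inter>\<xi>\<in>K. {z. (1 - (tanh (\<rho> n / 2))\<^sup>2) * (cmod (1 - cnj \<xi> * z))\<^sup>2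
        \<le> (1 - (cmod \<xi>)\<^sup>2) * (1 - (cmod z)\<^sup>2)})"
      by (auto simp: S_def)
    then show "compact (S n)"
      by (auto intro!: compact_Int_closed closed_INT closed_Collect_le continuous_intros)
    have "(INF z\<in>unit_disk. SUP \<zeta>\<in>K. hyp_dist z \<zeta>) < \<rho> n"
      by (simp add: \<rho>_def hyp_rad_def)
    then obtain z where z: "z \<in> unit_disk" "(SUP \<zeta>\<in>K. hyp_dist z \<zeta>) < \<rho> n"
      by (subst (asm) cINF_less_iff[OF _ bdd_below_SUP_hyp_dist[OF K]]) auto
    moreover obtain \<xi> where "(SUP \<zeta>\<in>K. hyp_dist z \<zeta>) = hyp_dist z \<xi>"
        "\<And>\<zeta>. \<zeta> \<in> K \<Longrightarrow> hyp_dist z \<zeta> \<le> hyp_dist z \<xi>"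
      using SUP_hyp_dist_attained[OF K z(1)] by blast
    ultimately have "z \<in> S n"
      unfolding S by fastforce
    then show "S n \<noteq> {}"
      by blast
  next
    fix m n :: nat assume "m \<le> n"
    then have "\<rho> n \<le> \<rho> m"
      by (simp add: \<rho>_def frac_le)
    then show "S n \<subseteq> S m"
      unfolding subset_iff S by force
  qed
  then obtain a where a: "\<And>n. a \<in> S n"
    by blast
  show ?thesis
  proof
    show "a \<in> unit_disk"
      using a S by blast
    fix \<xi> assume "\<xi> \<in> K"
    then have "hyp_dist a \<xi> \<le> \<rho> n" for n
      using a S by blast
    moreover have "\<rho> \<longlonglongrightarrow> hyp_rad K + 0"
      unfolding \<rho>_def by (intro tendsto_intros LIMSEQ_Suc[OF lim_1_over_n])
    ultimately show "hyp_dist a \<xi> \<le> hyp_rad K"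
      by (intro LIMSEQ_le_const[of \<rho>]) auto
  qed
qed

text \<open>For a minimiser \<open>a\<close>, a hull missing 0 would yield a point whose supremum,
  being attained, is below the infimum. So the hull contains 0, and
  \<open>hyp_circumcenter_eqI\<close> identifies \<open>a\<close> with \<open>c\<close>.\<close>

lemma hyp_circumcenter_in_hull:
  fixes K :: "complex set"
  defines "c \<equiv> hyp_circumcenter K"
  assumes K: "compact K" "K \<noteq> {}" "K \<subseteq> unit_disk"
  shows "c \<in> unit_disk"
    and "0 \<in> convex hull (disk_moebius c ` {\<xi> \<in> K. hyp_dist c \<xi> = hyp_rad K})"
proof -
  obtain a where a: "a \<in> unit_disk" and le: "\<And>\<xi>. \<xi> \<in> K \<Longrightarrow> hyp_dist a \<xi> \<le> hyp_rad K"
    using hyp_rad_attained[OF K] by blast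
  have "hyp_rad K \<ge> 0"
    using K le hyp_dist_nonneg[OF a] by force
  have hull: "0 \<in> convex hull (disk_moebius a ` {\<xi> \<in> K. hyp_dist a \<xi> = hyp_rad K})"
  proof (rule ccontr)
    assume "\<not> ?thesis"
    then obtain z where z: "z \<in> unit_disk" and less: "\<And>\<xi>. \<xi> \<in> K \<Longrightarrow> hyp_dist z \<xi> < hyp_rad K"
      using exists_closer_point[OF K(1,3) a \<open>hyp_rad K \<ge> 0\<close> le] by blast
    obtain \<xi> where "\<xi> \<in> K" "(SUP \<zeta>\<in>K. hyp_dist z \<zeta>) = hyp_dist z \<xi>"
      using SUP_hyp_dist_attained[OF K z] by blast
    moreover have "hyp_rad K \<le> (SUP \<zeta>\<in>K. hyp_dist z \<zeta>)"
      unfolding hyp_rad_def by (rule cINF_lower[OF bdd_below_SUP_hyp_dist[OF K] z])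
    ultimately show False
      using less by fastforce
  qed
  have "c = a"
    unfolding c_def using hyp_circumcenter_eqI(2)[OF K(1,3) a le hull] .
  then show "c \<in> unit_disk" "0 \<in> convex hull (disk_moebius c ` {\<xi> \<in> K. hyp_dist c \<xi> = hyp_rad K})"
    using a hull by simp_all
qed

section \<open>Geodesics, midpoints and unit tangents\<close>

text \<open>On a diameter the pseudo-hyperbolic distance is the subtraction formula of
  \<open>tanh\<close>, so \<open>s\<close> is signed arc length from 0.\<close>

lemma hyp_dist_radial:
  assumes "cmod u = 1"
  shows "hyp_dist (of_real (tanh (s / 2)) * u) (of_real (tanh (t / 2)) * u) = \<bar>s - t\<bar>"
proof -
  define a b where "a = tanh (s / 2)" and "b = tanh (t / 2)"
  have ab: "\<bar>a\<bar> < 1" "\<bar>b\<bar> < 1"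
    using tanh_real_bounds by (auto simp: a_def b_def abs_less_iff minus_less_iff)
  have "cnj u * u = 1"
    using assms by (simp add: complex_norm_square[symmetric] mult.commute)
  then have "disk_moebius (of_real a * u) (of_real b * u) = of_real ((b - a) / (1 - a * b)) * u"
    by (simp add: disk_moebius_def left_diff_distrib mult.assoc mult.left_commute[of "cnj u"])
  also have "(b - a) / (1 - a * b) = tanh ((t - s) / 2)"
    using tanh_diff_real[of "t / 2" "s / 2"] by (simp add: a_def b_def diff_divide_distrib mult.commute)
  finally have "cmod (disk_moebius (of_real a * u) (of_real b * u)) = tanh (\<bar>s - t\<bar> / 2)"
    using assms by (simp add: norm_mult abs_minus_commute flip: tanh_real_abs)
  then show ?thesis
    using ab assms hyp_dist_eq_iff by (simp add: a_def b_def norm_mult)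
qed

text \<open>Isometric images of diameters. The shift \<open>s0\<close> chooses the starting point: 0
  starts at \<open>c\<close>, as for tangents, and a negative shift starts before \<open>c\<close>,
  as for midpoints.\<close>

lemma hyp_geodesicI:
  fixes s0 :: real
  assumes c: "c \<in> unit_disk" and u: "cmod u = 1" and L: "L \<ge> 0"
  defines "\<gamma> \<equiv> \<lambda>s. disk_moebius (- c) (of_real (tanh ((s + s0) / 2)) * u)"
  shows "hyp_geodesic \<gamma> (\<gamma> 0) (\<gamma> L)" "hyp_dist (\<gamma> 0) (\<gamma> L) = L"
proof -
  have c': "- c \<in> unit_disk"
    using c by simp
  have in_disk: "of_real (tanh (t / 2)) * u \<in> unit_disk" for t
    using u tanh_real_bounds[of "t / 2"] by (simp add: norm_mult abs_less_iff)
  have dist: "hyp_dist (\<gamma> s) (\<gamma> t) = \<bar>s - t\<bar>" for s t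
    unfolding \<gamma>_def hyp_dist_disk_moebius[OF c' in_disk in_disk] hyp_dist_radial[OF u] by simp
  show "hyp_dist (\<gamma> 0) (\<gamma> L) = L"
    using L by (simp add: dist)
  moreover have "\<gamma> s \<in> unit_disk" for s
    unfolding \<gamma>_def by (rule disk_moebius_in_disk[OF c' in_disk])
  ultimately show "hyp_geodesic \<gamma> (\<gamma> 0) (\<gamma> L)"
    by (auto simp: hyp_geodesic_def dist)
qed

text \<open>The hypothesis says that the triangle inequality through \<open>p\<close> from \<open>0\<close> to \<open>q\<close> is an equality.\<close>
lemma radial_if_norm_disk_moebius_eq:
  assumes p: "p \<in> unit_disk" and q: "q \<in> unit_disk" "q \<noteq> 0"
    and eq: "cmod (disk_moebius p q) = (cmod q - cmod p) / (1 - cmod p * cmod q)"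
  shows "p = of_real (cmod p) * sgn q"
proof -
  define a b D where "a = cmod p" and "b = cmod q" and "D = (cmod (1 - cnj p * q))\<^sup>2"
  have ab: "0 \<le> a" "a < 1" "0 < b" "b < 1"
    using p q by (auto simp: a_def b_def)
  then have "a * b < 1"
    using mult_strict_mono[of a 1 b 1] by simp
  have sq: "a\<^sup>2 < 1" "b\<^sup>2 < 1"
    using ab by (simp_all add: abs_square_less_1)
  have "D \<noteq> 0"
    using p q disk_moebius_denom[of p q] by (simp add: D_def)
  have "(1 - a\<^sup>2) * (1 - b\<^sup>2) / D = 1 - ((b - a) / (1 - a * b))\<^sup>2"
    using norm_disk_moebius[OF p q(1)] eq by (simp add: a_def b_def D_def)
  also have "\<dots> = ((1 - a * b)\<^sup>2 - (b - a)\<^sup>2) / (1 - a * b)\<^sup>2"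
    using \<open>a * b < 1\<close> by (simp add: power_divide field_simps)
  also have "(1 - a * b)\<^sup>2 - (b - a)\<^sup>2 = (1 - a\<^sup>2) * (1 - b\<^sup>2)"
    by (simp add: power2_eq_square algebra_simps)
  finally have "D = (1 - a * b)\<^sup>2"
    using sq \<open>a * b < 1\<close> \<open>D \<noteq> 0\<close> by (simp add: frac_eq_eq)
  \<comment> \<open>Expanding \<open>D\<close> leaves the equality case of Cauchy-Schwarz, so
    \<open>p\<close> and \<open>q\<close> lie on a common ray.\<close>
  then have "p \<bullet> q = cmod p * cmod q"
    unfolding D_def norm_one_minus_cnj_mult by (simp add: a_def b_def power2_eq_square algebra_simps)
  then have "a *\<^sub>R q = b *\<^sub>R p"
    by (simp add: norm_cauchy_schwarz_eq a_def b_def)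
  then show ?thesis
    using ab by (simp add: sgn_div_norm a_def b_def scaleR_conv_of_real field_simps)
qed

text \<open>The point at parameter \<open>s\<close> has distances \<open>s\<close> and
  \<open>L - s\<close> to the ends. With \<open>x\<close> moved to 0, this is equality in the
  triangle inequality, which fixes its ray and its modulus. Midpoint and tangent are thereby well
  defined.\<close>

lemma hyp_geodesic_unique:
  assumes x: "x \<in> unit_disk" and y: "y \<in> unit_disk" "x \<noteq> y" and \<gamma>: "hyp_geodesic \<gamma> x y"
    and s: "s \<in> {0..hyp_dist x y}"
  shows "\<gamma> s = disk_moebius (- x) (of_real (tanh (s / 2)) * sgn (disk_moebius x y))"
proof -
  define L p q where "L = hyp_dist x y" and "p = disk_moebius x (\<gamma> s)" and "q = disk_moebius x y"
  have \<gamma>s: "\<gamma> s \<in> unit_disk"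
    using \<gamma> s unfolding hyp_geodesic_def by blast
  have L: "0 \<in> {0..L}" "L \<in> {0..L}" "s \<in> {0..L}"
    using s hyp_dist_nonneg[OF x y(1)] by (auto simp: L_def)
  then have "hyp_dist (\<gamma> 0) (\<gamma> s) = \<bar>0 - s\<bar>" "hyp_dist (\<gamma> s) (\<gamma> L) = \<bar>s - L\<bar>"
    using \<gamma> unfolding hyp_geodesic_def L_def by blast+
  then have d: "hyp_dist x (\<gamma> s) = s" "hyp_dist (\<gamma> s) y = L - s"
    using \<gamma> L by (auto simp: hyp_geodesic_def L_def)
  have p: "p \<in> unit_disk" "cmod p = tanh (s / 2)"
    unfolding p_def using d hyp_dist_eq_iff[OF x \<gamma>s] disk_moebius_in_disk[OF x \<gamma>s] by auto
  have q: "q \<in> unit_disk" "cmod q = tanh (L / 2)"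
    unfolding q_def using hyp_dist_eq_iff[OF x y(1)] disk_moebius_in_disk[OF x y(1)]
    by (auto simp: L_def)
  have "q \<noteq> 0"
    using disk_moebius_inverse[OF x y(1)] y(2) by (auto simp: q_def)
  have "hyp_dist p q = L - s"
    unfolding p_def q_def hyp_dist_disk_moebius[OF x \<gamma>s y(1)] by (rule d)
  then have "cmod (disk_moebius p q) = tanh (L / 2 - s / 2)"
    using hyp_dist_eq_iff[OF p(1) q(1)] by (simp add: diff_divide_distrib)
  then have "cmod (disk_moebius p q) = (cmod q - cmod p) / (1 - cmod p * cmod q)"
    unfolding p(2) q(2) tanh_diff_real by (simp add: mult.commute)
  then have "p = of_real (cmod p) * sgn q"
    by (rule radial_if_norm_disk_moebius_eq[OF p(1) q(1) \<open>q \<noteq> 0\<close>])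
  then have "disk_moebius (- x) p = disk_moebius (- x) (of_real (tanh (s / 2)) * sgn q)"
    using p(2) by simp
  then show ?thesis
    unfolding p_def q_def disk_moebius_inverse[OF x \<gamma>s] .
qed

lemma hyp_midpoint_eqI:
  assumes x: "x \<in> unit_disk" and y: "y \<in> unit_disk" "x \<noteq> y" and \<gamma>: "hyp_geodesic \<gamma> x y"
  shows "hyp_midpoint x y = \<gamma> (hyp_dist x y / 2)"
  unfolding hyp_midpoint_def
proof (rule the_equality)
  have "hyp_dist x y / 2 \<in> {0..hyp_dist x y}"
    using hyp_dist_nonneg[OF x y(1)] by simp
  then show "m = \<gamma> (hyp_dist x y / 2)"
    if "\<exists>\<gamma>. hyp_geodesic \<gamma> x y \<and> m = \<gamma> (hyp_dist x y / 2)" for m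
    using that \<gamma> hyp_geodesic_unique[OF x y] by metis
qed (use \<gamma> in blast)

lemma hyp_midpoint_antipodal:
  assumes c: "c \<in> unit_disk" and x: "x \<in> unit_disk" and y: "y \<in> unit_disk" "x \<noteq> y"
    and antipodal: "disk_moebius c x = - disk_moebius c y"
  shows "hyp_midpoint x y = c"
proof -
  define q R where "q = disk_moebius c y" and "R = hyp_dist c y"
  \<comment> \<open>With shift \<open>- R\<close> this diameter is at \<open>x\<close> for parameter
    0, at \<open>c\<close> for \<open>R\<close> and at \<open>y\<close> for
    \<open>2 * R\<close>.\<close>
  define \<gamma> where "\<gamma> s = disk_moebius (- c) (of_real (tanh ((s + - R) / 2)) * sgn q)" for s
  have "q \<noteq> 0"
    using antipodal y(2) disk_moebius_inverse[OF c x] disk_moebius_inverse[OF c y(1)]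
    by (auto simp: q_def)
  then have u: "cmod (sgn q) = 1"
    by (simp add: norm_sgn)
  have R: "R \<ge> 0" "tanh (R / 2) = cmod q"
    unfolding R_def q_def using hyp_dist_nonneg[OF c y(1)] tanh_half_hyp_dist[OF c y(1)] by auto
  have polar: "of_real (cmod q) * sgn q = q"
    using \<open>q \<noteq> 0\<close> by (simp add: sgn_div_norm scaleR_conv_of_real)
  have "\<gamma> 0 = disk_moebius (- c) (- q)"
    using R polar by (simp add: \<gamma>_def)
  then have \<gamma>0: "\<gamma> 0 = x"
    using antipodal disk_moebius_inverse[OF c x] by (simp add: q_def)
  have \<gamma>1: "\<gamma> (2 * R) = y"
    using R polar disk_moebius_inverse[OF c y(1)] by (simp add: \<gamma>_def q_def)
  have "hyp_geodesic \<gamma> x y" "hyp_dist x y = 2 * R"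
    using hyp_geodesicI[OF c u, of "2 * R" "- R"] R(1)
    unfolding \<gamma>_def[symmetric] \<gamma>0 \<gamma>1 by auto
  then show ?thesis
    using hyp_midpoint_eqI[OF x y] by (simp add: \<gamma>_def)
qed

text \<open>Chain rule: the radial geodesic leaves 0 with velocity \<open>u / 2\<close>, and
  \<open>disk_moebius (- x)\<close> has derivative \<open>1 - (cmod x)\<^sup>2\<close> at 0.\<close>

lemma hyp_unit_tangent_eq:
  assumes x: "x \<in> unit_disk" and y: "y \<in> unit_disk" "x \<noteq> y"
  shows "hyp_unit_tangent x y = ((1 - (cmod x)\<^sup>2) / 2) *\<^sub>R sgn (disk_moebius x y)"
proof -
  define L q u where "L = hyp_dist x y" and "q = disk_moebius x y" and "u = sgn q"
  define \<gamma> where "\<gamma> s = disk_moebius (- x) (of_real (tanh ((s + 0) / 2)) * u)" for s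
  define v where "v = ((1 - (cmod x)\<^sup>2) / 2) *\<^sub>R u"
  have "q \<noteq> 0"
    using disk_moebius_inverse[OF x y(1)] y(2) by (auto simp: q_def)
  then have u: "cmod u = 1"
    by (simp add: u_def norm_sgn)
  have polar: "of_real (cmod q) * u = q"
    using \<open>q \<noteq> 0\<close> by (simp add: u_def sgn_div_norm scaleR_conv_of_real)
  have L: "tanh (L / 2) = cmod q"
    unfolding L_def q_def by (rule tanh_half_hyp_dist[OF x y(1)])
  then have "L > 0"
    using \<open>q \<noteq> 0\<close> tanh_real_pos_iff[of "L / 2"] by simp
  have "\<gamma> 0 = x" "\<gamma> L = y"
    using L polar disk_moebius_inverse[OF x y(1)] by (simp_all add: \<gamma>_def q_def)
  then have geo: "hyp_geodesic \<gamma> x y"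
    using hyp_geodesicI(1)[OF x u, of L 0] \<open>L > 0\<close> unfolding \<gamma>_def[symmetric] by simp
  have deriv: "(\<gamma> has_vector_derivative v) (at 0 within {0..L})"
  proof -
    have "((\<lambda>s::real. tanh ((s + 0) / 2)) has_field_derivative 1 / 2) (at 0 within {0..L})"
      by (auto intro!: derivative_eq_intros)
    then have 1: "((\<lambda>s::real. of_real (tanh ((s + 0) / 2)) * u) has_vector_derivative of_real (1 / 2) * u)
        (at 0 within {0..L})"
      by (intro has_vector_derivative_mult_left has_vector_derivative_of_real)
         (simp add: has_real_derivative_iff_has_vector_derivative)
    have "(disk_moebius (- x) has_field_derivative 1 - cnj x * x) (at 0)"
      unfolding disk_moebius_def by (auto intro!: derivative_eq_intros)
    then have "(disk_moebius (- x) has_field_derivative of_real (1 - (cmod x)\<^sup>2))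
        (at (of_real (tanh ((0 + 0) / 2)) * u) within
          (\<lambda>s::real. of_real (tanh ((s + 0) / 2)) * u) ` {0..L})"
      by (auto intro: has_field_derivative_at_within simp: complex_norm_square mult.commute
          simp del: of_real_power)
    from field_vector_diff_chain_within[OF 1 this] show ?thesis
      by (simp add: o_def \<gamma>_def[abs_def] v_def scaleR_conv_of_real mult_ac)
  qed
  \<comment> \<open>Geodesics are determined on \<open>{0..L}\<close> only; since
    \<open>L > 0\<close>, the one-sided derivative at 0 is still unique.\<close>
  have "w = v" if "hyp_geodesic \<delta> x y" "(\<delta> has_vector_derivative w) (at 0 within {0..L})" for w \<delta>
  proof -
    have "\<delta> s = \<gamma> s" if "s \<in> {0..L}" for s
      using hyp_geodesic_unique[OF x y \<open>hyp_geodesic \<delta> x y\<close>] that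
      by (simp add: \<gamma>_def u_def q_def L_def)
    then have "(\<gamma> has_vector_derivative w) (at 0 within {0..L})"
      using \<open>L > 0\<close> that(2) by (intro has_vector_derivative_transform[of 0 "{0..L}" \<gamma> \<delta>]) auto
    with deriv show ?thesis
      using vector_derivative_unique_within_closed_interval[of 0 L 0 \<gamma> w v] \<open>L > 0\<close> by simp
  qed
  then have "hyp_unit_tangent x y = v"
    unfolding hyp_unit_tangent_def L_def[symmetric]
    using geo deriv by (intro the_equality) blast+
  then show ?thesis
    by (simp add: v_def u_def q_def)
qed

section \<open>The closure of the image of the dilatation\<close>

lemma closure_dilatation_in_disk:
  assumes "orientation_preserving_harmonic f h g" and "sup_norm (dilatation h g) < 1"
  shows "compact (closure (dilatation h g ` unit_disk))"
    and "closure (dilatation h g ` unit_disk) \<subseteq> unit_disk"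
proof -
  \<comment> \<open>Positivity of the Jacobian supplies the boundedness that makes
    \<open>sup_norm\<close> a genuine supremum.\<close>
  have "cmod (dilatation h g z) \<le> 1" if "z \<in> unit_disk" for z
  proof -
    have "(cmod (deriv g z))\<^sup>2 < (cmod (deriv h z))\<^sup>2"
      using assms(1) that by (auto simp: orientation_preserving_harmonic_def)
    then have "cmod (deriv g z) < cmod (deriv h z)"
      by (simp add: power_less_imp_less_base)
    then show ?thesis
      by (simp add: dilatation_def norm_divide divide_le_eq_1)
  qed
  then have "bdd_above ((\<lambda>z. cmod (dilatation h g z)) ` unit_disk)"
    by (intro bdd_aboveI2)
  then have "dilatation h g ` unit_disk \<subseteq> cball 0 (sup_norm (dilatation h g))"
    unfolding sup_norm_def by (auto intro!: cSUP_upper)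
  then have sub: "closure (dilatation h g ` unit_disk) \<subseteq> cball 0 (sup_norm (dilatation h g))"
    by (intro closure_minimal) auto
  then show "compact (closure (dilatation h g ` unit_disk))"
    using bounded_subset[OF bounded_cball] by (auto simp: compact_eq_bounded_closed)
  show "closure (dilatation h g ` unit_disk) \<subseteq> unit_disk"
    using sub assms(2) by (auto simp: subset_iff)
qed

section \<open>Selection of two or three farthest points\<close>

theorem theorem1p3:
  fixes f h g :: "complex \<Rightarrow> complex" and c :: complex and R :: real
  assumes "orientation_preserving_harmonic f h g"
    and "sup_norm (dilatation h g) < 1"
    and "c = hyp_circumcenter (closure (dilatation h g ` unit_disk))"
    and "R = hyp_rad (closure (dilatation h g ` unit_disk))"
    and "R > 0"
  shows "\<exists>m \<in> {2, 3 :: nat}. \<exists>\<xi> :: nat \<Rightarrow> complex.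
           inj_on \<xi> {1..m} \<and>
           (\<forall>j\<in>{1..m}. \<xi> j \<in> closure (dilatation h g ` unit_disk) \<and> hyp_dist c (\<xi> j) = R) \<and>
           c = hyp_circumcenter (\<xi> ` {1..m}) \<and>
           (m = 2 \<longrightarrow> c = hyp_midpoint (\<xi> 1) (\<xi> 2)) \<and>
           (m = 3 \<longrightarrow> 0 \<in> convex hull ((\<lambda>j. hyp_unit_tangent c (\<xi> j)) ` {1..m}))"
proof -
  define K where "K = closure (dilatation h g ` unit_disk)"
  have K: "compact K" "K \<noteq> {}" "K \<subseteq> unit_disk"
    using closure_dilatation_in_disk[OF assms(1,2)] by (auto simp: K_def)
  define F r where "F = {\<xi> \<in> K. hyp_dist c \<xi> = R}" and "r = tanh (R / 2)"
  have cK: "c = hyp_circumcenter K" and RK: "R = hyp_rad K"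
    using assms by (simp_all add: K_def)
  have c: "c \<in> unit_disk" and hull: "0 \<in> convex hull (disk_moebius c ` F)"
    using hyp_circumcenter_in_hull[OF K] by (simp_all add: F_def flip: cK RK)
  have "r > 0"
    using \<open>R > 0\<close> by (simp add: r_def)
  have F: "F \<subseteq> unit_disk"
    using K by (auto simp: F_def)
  \<comment> \<open>Caratheodory in real dimension 2 gives at most 2 + 1 points.\<close>
  obtain S where S: "finite S" "S \<subseteq> disk_moebius c ` F" "card S \<le> 3" "0 \<in> convex hull S"
    using hull by (subst (asm) caratheodory) auto
  have norm_S: "cmod p = r" if "p \<in> S" for p
  proof -
    obtain \<xi> where "\<xi> \<in> F" "p = disk_moebius c \<xi>"
      using \<open>p \<in> S\<close> S(2) by blast
    then show ?thesis
      using F tanh_half_hyp_dist[OF c, of \<xi>] by (auto simp: F_def r_def)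
  qed
  define m where "m = card S"
  \<comment> \<open>An empty hull misses 0, and so does a single point of modulus
    \<open>r > 0\<close>; here \<open>R > 0\<close> excludes \<open>m = 1\<close>.\<close>
  have "S \<noteq> {}"
    using S(4) by auto
  moreover have "S \<noteq> {p}" for p
    using S(4) norm_S \<open>r > 0\<close> by auto
  ultimately have "m \<noteq> 0" "m \<noteq> 1"
    using S(1) card_1_singletonE[of S] unfolding m_def by (metis card_0_eq, metis)
  then have m: "m \<in> {2, 3}"
    using S(3) unfolding m_def insert_iff empty_iff by linarith
  obtain b where b: "bij_betw b {1..m} S"
    using ex_bij_betw_nat_finite_1[OF S(1)] by (auto simp: m_def)
  define \<xi> where "\<xi> j = disk_moebius (- c) (b j)" for j
  have \<xi>: "\<xi> j \<in> F" "disk_moebius c (\<xi> j) = b j" if "j \<in> {1..m}" for j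
  proof -
    obtain \<eta> where \<eta>: "\<eta> \<in> F" "b j = disk_moebius c \<eta>"
      using bij_betw_apply[OF b \<open>j \<in> {1..m}\<close>] S(2) by blast
    then have "\<xi> j = \<eta>"
      unfolding \<xi>_def using disk_moebius_inverse[OF c, of \<eta>] F by auto
    then show "\<xi> j \<in> F" "disk_moebius c (\<xi> j) = b j"
      using \<eta> by simp_all
  qed
  have inj: "inj_on \<xi> {1..m}"
    using \<xi>(2) b by (metis bij_betw_imp_inj_on inj_on_def)
  have circumcenter: "hyp_circumcenter (\<xi> ` {1..m}) = c"
  proof (rule hyp_circumcenter_eqI)
    show "compact (\<xi> ` {1..m})"
      by (intro finite_imp_compact) auto
    show "\<xi> ` {1..m} \<subseteq> unit_disk"
      using \<xi>(1) F by blast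
    \<comment> \<open>All selected points are at distance \<open>R\<close>, so the farthest points
      of the selection are the whole selection, with image \<open>S\<close>.\<close>
    have eq: "{\<zeta> \<in> \<xi> ` {1..m}. hyp_dist c \<zeta> = R} = \<xi> ` {1..m}"
      using \<xi>(1) by (auto simp: F_def)
    have "disk_moebius c ` \<xi> ` {1..m} = S"
      using \<xi>(2) bij_betw_imp_surj_on[OF b] by (simp add: image_image)
    then show "0 \<in> convex hull (disk_moebius c ` {\<zeta> \<in> \<xi> ` {1..m}. hyp_dist c \<zeta> = R})"
      unfolding eq using S(4) by simp
    show "hyp_dist c \<zeta> \<le> R" if "\<zeta> \<in> \<xi> ` {1..m}" for \<zeta>
      using that \<xi>(1) by (auto simp: F_def)
  qed (rule c)
  have midpoint: "hyp_midpoint (\<xi> 1) (\<xi> 2) = c" if "m = 2"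
  proof -
    have 12: "1 \<in> {1..m}" "2 \<in> {1..m}" "{1..m} = {1, 2}"
      using that by auto
    then have "S = {b 1, b 2}"
      using bij_betw_imp_surj_on[OF b] by auto
    then obtain s t where st: "0 \<le> s" "0 \<le> t" "s + t = 1" "s *\<^sub>R b 1 + t *\<^sub>R b 2 = 0"
      using S(4) by (auto simp: convex_hull_2)
    \<comment> \<open>Both points have modulus \<open>r > 0\<close>, so the two weights coincide and
      the points are antipodal.\<close>
    then have "cmod (s *\<^sub>R b 1) = cmod (t *\<^sub>R b 2)"
      by (metis add_eq_0_iff norm_minus_cancel)
    then have "s = t"
      using st norm_S \<open>S = {b 1, b 2}\<close> \<open>r > 0\<close> by simp
    then have "b 1 = - b 2"
      using st by (simp add: add_eq_0_iff flip: scaleR_add_right)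
    moreover have "\<xi> 1 \<noteq> \<xi> 2"
      using inj_onD[OF inj _ 12(1,2)] by auto
    ultimately show ?thesis
      using \<xi>[OF 12(1)] \<xi>[OF 12(2)] F c by (intro hyp_midpoint_antipodal) auto
  qed
  have tangents: "0 \<in> convex hull ((\<lambda>j. hyp_unit_tangent c (\<xi> j)) ` {1..m})"
  proof -
    \<comment> \<open>Since all \<open>b j\<close> have modulus \<open>r\<close>, normalising them
      and rescaling to unit tangents is multiplication by one constant, under which the hull still
      contains 0.\<close>
    define k where "k = (1 - (cmod c)\<^sup>2) / 2 / r"
    have "hyp_unit_tangent c (\<xi> j) = k *\<^sub>R b j" if j: "j \<in> {1..m}" for j
    proof -
      have bj: "cmod (b j) = r"
        using norm_S bij_betw_apply[OF b j] by blast
      then have "c \<noteq> \<xi> j"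
        using \<xi>(2)[OF j] \<open>r > 0\<close> by auto
      then have "hyp_unit_tangent c (\<xi> j) = ((1 - (cmod c)\<^sup>2) / 2) *\<^sub>R sgn (b j)"
        using hyp_unit_tangent_eq[OF c, of "\<xi> j"] \<xi>[OF j] F by auto
      then show ?thesis
        by (simp only: k_def sgn_div_norm bj scaleR_scaleR divide_inverse[of _ r])
    qed
    then have "(\<lambda>j. hyp_unit_tangent c (\<xi> j)) ` {1..m} = (\<lambda>j. k *\<^sub>R b j) ` {1..m}"
      by (rule image_cong[OF refl])
    also have "\<dots> = (*\<^sub>R) k ` S"
      unfolding bij_betw_imp_surj_on[OF b, symmetric] image_image ..
    finally have "(\<lambda>j. hyp_unit_tangent c (\<xi> j)) ` {1..m} = (*\<^sub>R) k ` S" .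
    then show ?thesis
      using S(4) by (auto simp: convex_hull_scaling intro: image_eqI[of _ _ 0])
  qed
  have "\<forall>j\<in>{1..m}. \<xi> j \<in> closure (dilatation h g ` unit_disk) \<and> hyp_dist c (\<xi> j) = R"
    using \<xi>(1) by (auto simp: F_def K_def)
  then show ?thesis
    using m inj circumcenter midpoint tangents by (intro bexI[of _ m] exI[of _ \<xi>]) auto
qed

end
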